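(* Let $\mathcal{F}$ be a family of finite posets that is closed under taking order ideals and order filters, and such that for every $P\in\mathcal{F}$ the coefficient of the linear term of the order polynomial $\Omega_P(n)$ is nonnegative. Then for any $P\in\mathcal{F}$, any subset $A\subseteq P$ (with the induced order) with $\min(P)\cup\max(P)\subseteq A$, and any $\lambda\colon A\to\mathbb{Z}$, the marked order polytope $\mathcal{O}_{P,A}(\lambda)$ is Ehrhart positive.
   Context: For a finite poset $P$ and a positive integer $n$, $\Omega_P(n)$ (the order polynomial) is the number of order preserving maps $g\colon P\to\{1,\ldots,n\}$ (i.e. $g(p)\le g(q)$ whenever $p\prec_P q$); it is a polynomial in $n$. Ideals are downward closed subsets, filters upward closed subsets; the family being closed under them means the induced subposet on any ideal or filter of a member is again a member. $\min(P),\max(P)$ are the sets of minimal and maximal elements. The marked order polytope is $\mathcal{O}_{P,A}(\lambda)=\{\hat\lambda\colon P\to\mathbb{R}\text{ order preserving with }\hat\lambda(a)=\lambda(a)\ \forall a\in A\}\subset\mathbb{R}^P$; when $\min(P)\cup\max(P)\subseteq A$ and $\lambda$ is integer-valued it is a (possibly empty) lattice polytope. A lattice polytope $Q\subset\mathbb{R}^d$ is Ehrhart positive if its Ehrhart polynomial $E_Q(n)=|nQ\cap\mathbb{Z}^d|$ ($n\ge0$) has only nonnegative coefficients. *)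

theory Defs
  imports Complex_Main "HOL-Library.FuncSet" "HOL-Computational_Algebra.Polynomial"
begin

text \<open>
  A finite poset is a finite carrier \<open>P\<close> together with a relation \<open>r\<close> such that
  \<open>partial_order_on P r\<close>, where \<open>(p, q) \<in> r\<close> means \<open>p\<close> is below or equal to \<open>q\<close>.
  The order induced on \<open>Q \<subseteq> P\<close> is \<open>Restr r Q\<close>.
\<close>

definition order_ideal :: "'a set \<Rightarrow> 'a rel \<Rightarrow> 'a set \<Rightarrow> bool" where
  "order_ideal P r I \<longleftrightarrow> I \<subseteq> P \<and> (\<forall>q\<in>I. \<forall>p\<in>P. (p, q) \<in> r \<longrightarrow> p \<in> I)"

definition order_filter :: "'a set \<Rightarrow> 'a rel \<Rightarrow> 'a set \<Rightarrow> bool" where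
  "order_filter P r J \<longleftrightarrow> J \<subseteq> P \<and> (\<forall>p\<in>J. \<forall>q\<in>P. (p, q) \<in> r \<longrightarrow> q \<in> J)"

definition min_elements :: "'a set \<Rightarrow> 'a rel \<Rightarrow> 'a set" where
  "min_elements P r = {p \<in> P. \<forall>q\<in>P. (q, p) \<in> r \<longrightarrow> q = p}"

definition max_elements :: "'a set \<Rightarrow> 'a rel \<Rightarrow> 'a set" where
  "max_elements P r = {p \<in> P. \<forall>q\<in>P. (p, q) \<in> r \<longrightarrow> q = p}"

definition order_preserving :: "'a set \<Rightarrow> 'a rel \<Rightarrow> ('a \<Rightarrow> 'b::order) \<Rightarrow> bool" where
  "order_preserving P r g \<longleftrightarrow> monotone_on P (\<lambda>p q. (p, q) \<in> r) (\<le>) g"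

definition order_maps :: "'a set \<Rightarrow> 'a rel \<Rightarrow> nat \<Rightarrow> ('a \<Rightarrow> nat) set" where
  "order_maps P r n = {g \<in> P \<rightarrow>\<^sub>E {1..n}. order_preserving P r g}"

text \<open>For a finite poset there is exactly one such polynomial.\<close>

definition order_polynomial :: "'a set \<Rightarrow> 'a rel \<Rightarrow> real poly" where
  "order_polynomial P r =
     (THE f. \<forall>n\<ge>1. poly f (real n) = real (card (order_maps P r n)))"

text \<open>
  For a finite index set \<open>S\<close>, the space of real vectors indexed by \<open>S\<close> is modelled by
  \<open>S \<rightarrow>\<^sub>E UNIV\<close> (functions that are \<open>undefined\<close> outside \<open>S\<close>), and its lattice of integer points
  by \<open>S \<rightarrow>\<^sub>E \<int>\<close>.
\<close>

definition convex_hull_on :: "'a set \<Rightarrow> ('a \<Rightarrow> real) set \<Rightarrow> ('a \<Rightarrow> real) set" where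
  "convex_hull_on S V =
     {(\<lambda>s\<in>S. \<Sum>v\<in>V. c v * v s) | c. (\<forall>v\<in>V. 0 \<le> c v) \<and> (\<Sum>v\<in>V. c v) = 1}"

text \<open>The formula above is the convex hull for finite \<open>V\<close>; for \<open>V = {}\<close> it is empty.\<close>

definition lattice_polytope :: "'a set \<Rightarrow> ('a \<Rightarrow> real) set \<Rightarrow> bool" where
  "lattice_polytope S Q \<longleftrightarrow> (\<exists>V. finite V \<and> V \<subseteq> S \<rightarrow>\<^sub>E \<int> \<and> Q = convex_hull_on S V)"

definition dilate :: "'a set \<Rightarrow> nat \<Rightarrow> ('a \<Rightarrow> real) set \<Rightarrow> ('a \<Rightarrow> real) set" where
  "dilate S n Q = (\<lambda>x. \<lambda>s\<in>S. real n * x s) ` Q"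

text \<open>
  By Ehrhart's theorem there is exactly one such polynomial if \<open>Q\<close> is a lattice polytope; it is
  zero if \<open>Q = {}\<close>.
\<close>

definition ehrhart_polynomial :: "'a set \<Rightarrow> ('a \<Rightarrow> real) set \<Rightarrow> real poly" where
  "ehrhart_polynomial S Q =
     (THE f. \<forall>n::nat. poly f (real n) = real (card (dilate S n Q \<inter> (S \<rightarrow>\<^sub>E \<int>))))"

definition ehrhart_positive :: "'a set \<Rightarrow> ('a \<Rightarrow> real) set \<Rightarrow> bool" where
  "ehrhart_positive S Q \<longleftrightarrow>
     lattice_polytope S Q \<and> (\<forall>i. 0 \<le> coeff (ehrhart_polynomial S Q) i)"

definition marked_order_polytope ::
    "'a set \<Rightarrow> 'a rel \<Rightarrow> 'a set \<Rightarrow> ('a \<Rightarrow> int) \<Rightarrow> ('a \<Rightarrow> real) set" where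
  "marked_order_polytope P r A lam =
     {x \<in> P \<rightarrow>\<^sub>E UNIV. order_preserving P r x \<and> (\<forall>a\<in>A. x a = of_int (lam a))}"

end

theory Submission
  imports Defs
begin

text \<open>
  Splitting an order preserving map at a threshold gives
  \<open>\<Omega>\<^sub>P(m + n) = (\<Sum>I. \<Omega>\<^sub>I(m) \<Omega>\<^bsub>P - I\<^esub>(n))\<close>, the sum being over the order ideals of \<open>P\<close>.
  Comparing linear coefficients in \<open>n\<close> expresses the derivative of \<open>\<Omega>\<^sub>P\<close> as a combination of the
  \<open>\<Omega>\<^sub>I\<close> whose weights are linear coefficients of the \<open>\<Omega>\<^bsub>P - I\<^esub>\<close>, so by induction on \<open>|P|\<close> all
  coefficients of \<open>\<Omega>\<^sub>P\<close> are nonnegative.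

  The lattice points \<open>g\<close> of the \<open>n\<close>-th dilate are grouped by the lattice point \<open>h = \<lceil>g / n\<rceil>\<close> of the
  polytope. An element \<open>p\<close> above a marked \<open>a\<close> with \<open>h a = h p\<close> is forced to have \<open>g p = n h(p)\<close>; the
  unforced elements of a level set of \<open>h\<close> form an ideal of a filter of an ideal of \<open>P\<close>, on which \<open>g\<close>
  is, up to translation, an arbitrary order preserving map to \<open>{1..n}\<close>. So the Ehrhart polynomial is
  a sum of products of order polynomials of members of the family.
\<close>

section \<open>Polynomials determined on the naturals, and products with nonnegative
  coefficients\<close>

lemma poly_eqI_nat:
  fixes f g :: "real poly"
  assumes "\<And>n. n \<ge> N \<Longrightarrow> poly f (real n) = poly g (real n)"
  shows "f = g"
proof (rule ccontr)
  assume "f \<noteq> g"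
  then have "finite {x. poly (f - g) x = 0}"
    by (simp add: poly_roots_finite del: poly_diff)
  moreover have "real ` {N..} \<subseteq> {x. poly (f - g) x = 0}"
    using assms by auto
  ultimately have "finite (real ` {N..})"
    by (rule finite_subset[rotated])
  then have "finite {N..}"
    by (simp add: finite_image_iff inj_on_def)
  then show False
    by (simp add: infinite_Ici)
qed

lemma nonneg_coeff_mult:
  fixes f g :: "real poly"
  assumes "\<And>i. 0 \<le> coeff f i" and "\<And>i. 0 \<le> coeff g i"
  shows "0 \<le> coeff (f * g) i"
  unfolding coeff_mult by (intro sum_nonneg mult_nonneg_nonneg assms)

lemma nonneg_coeff_prod:
  fixes f :: "'k \<Rightarrow> real poly"
  assumes "\<And>k i. k \<in> K \<Longrightarrow> 0 \<le> coeff (f k) i"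
  shows "0 \<le> coeff (\<Prod>k\<in>K. f k) i"
  using assms
proof (induction K arbitrary: i rule: infinite_finite_induct)
  case (insert k K)
  then show ?case
    by (simp add: nonneg_coeff_mult)
qed simp_all

section \<open>Counting order preserving maps\<close>

lemma order_preservingI:
  "(\<And>p q. p \<in> P \<Longrightarrow> q \<in> P \<Longrightarrow> (p, q) \<in> r \<Longrightarrow> g p \<le> g q) \<Longrightarrow> order_preserving P r g"
  unfolding order_preserving_def by (rule monotone_onI)

lemma order_preservingD:
  "order_preserving P r g \<Longrightarrow> (p, q) \<in> r \<Longrightarrow> p \<in> P \<Longrightarrow> q \<in> P \<Longrightarrow> g p \<le> g q"
  unfolding order_preserving_def by (rule monotone_onD)

lemma order_mapsI:
  assumes "g \<in> P \<rightarrow>\<^sub>E {1..n}"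
    and "\<And>p q. p \<in> P \<Longrightarrow> q \<in> P \<Longrightarrow> (p, q) \<in> r \<Longrightarrow> g p \<le> g q"
  shows "g \<in> order_maps P r n"
  using assms unfolding order_maps_def by (auto intro: order_preservingI)

lemma order_mapsD:
  assumes "g \<in> order_maps P r n"
  shows "g \<in> P \<rightarrow>\<^sub>E {1..n}"
    and "\<And>p. p \<in> P \<Longrightarrow> 1 \<le> g p"
    and "\<And>p. p \<in> P \<Longrightarrow> g p \<le> n"
    and "\<And>p q. p \<in> P \<Longrightarrow> q \<in> P \<Longrightarrow> (p, q) \<in> r \<Longrightarrow> g p \<le> g q"
  using assms unfolding order_maps_def by (fastforce dest: order_preservingD)+

lemma finite_order_maps: "finite P \<Longrightarrow> finite (order_maps P r n)"
  unfolding order_maps_def by (simp add: finite_PiE)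

lemma order_maps_Restr: "W \<subseteq> V \<Longrightarrow> order_maps W (Restr r V) n = order_maps W r n"
  unfolding order_maps_def order_preserving_def monotone_on_def by blast

lemma order_polynomial_Restr:
  "W \<subseteq> V \<Longrightarrow> order_polynomial W (Restr r V) = order_polynomial W r"
  unfolding order_polynomial_def by (simp add: order_maps_Restr)

lemma card_order_maps_empty: "card (order_maps {} r n) = 1"
  unfolding order_maps_def order_preserving_def monotone_on_def by simp

lemma card_order_maps_0: "P \<noteq> {} \<Longrightarrow> card (order_maps P r 0) = 0"
  unfolding order_maps_def by (auto simp: PiE_eq_empty_iff)

lemma card_order_maps_1: "card (order_maps P r 1) = 1"
proof -
  have "order_maps P r 1 = {\<lambda>p\<in>P. 1}"
    unfolding order_maps_def order_preserving_def monotone_on_def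
    by (auto simp: PiE_iff fun_eq_iff extensional_def)
  then show ?thesis by simp
qed

lemma finite_order_ideals: "finite P \<Longrightarrow> finite {I. order_ideal P r I}"
  by (rule finite_subset[of _ "Pow P"]) (auto simp: order_ideal_def)

text \<open>A map corresponds to its sublevel set at \<open>m\<close>, its restriction there, and
  the remaining values shifted down by \<open>m\<close>. Gluing is monotone because values on the
  ideal are at most \<open>m\<close> and all others exceed \<open>m\<close>.\<close>

lemma card_order_maps_add:
  assumes "finite P"
  shows "card (order_maps P r (m + n)) =
    (\<Sum>I | order_ideal P r I. card (order_maps I r m) * card (order_maps (P - I) r n))"
proof -
  define X where
    "X = (SIGMA I:{I. order_ideal P r I}. order_maps I r m \<times> order_maps (P - I) r n)"
  define split where "split = (\<lambda>g :: 'a \<Rightarrow> nat.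
    ({p \<in> P. g p \<le> m}, restrict g {p \<in> P. g p \<le> m}, \<lambda>p\<in>{p \<in> P. \<not> g p \<le> m}. g p - m))"
  define glue where "glue = (\<lambda>(I, f, g). \<lambda>p\<in>P. if p \<in> I then f p else (g p + m :: nat))"
  have "bij_betw split (order_maps P r (m + n)) X"
  proof (rule bij_betw_byWitness[where f' = glue])
    show "\<forall>g\<in>order_maps P r (m + n). glue (split g) = g"
      unfolding glue_def split_def order_maps_def
      by (auto simp: fun_eq_iff PiE_iff extensional_def)
  next
    show "\<forall>t\<in>X. split (glue t) = t"
    proof
      fix t assume "t \<in> X"
      then obtain I f g where t: "t = (I, f, g)" and I: "order_ideal P r I"
        and f: "f \<in> order_maps I r m" and g: "g \<in> order_maps (P - I) r n"
        unfolding X_def by auto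
      have IP: "I \<subseteq> P" using I by (simp add: order_ideal_def)
      have eq: "{p \<in> P. glue t p \<le> m} = I" "{p \<in> P. \<not> glue t p \<le> m} = P - I"
        using order_mapsD(3)[OF f] order_mapsD(2)[OF g] IP
        by (force simp: glue_def t)+
      have "restrict (glue t) I = f"
        using order_mapsD(1)[OF f] IP
        by (auto simp: glue_def t fun_eq_iff PiE_iff extensional_def)
      moreover have "(\<lambda>p\<in>P - I. glue t p - m) = g"
        using order_mapsD(1)[OF g]
        by (auto simp: glue_def t fun_eq_iff PiE_iff extensional_def)
      ultimately have "split (glue t) = (I, f, g)"
        by (simp add: split_def eq)
      then show "split (glue t) = t"
        by (simp only: t)
    qed
  next
    show "split ` order_maps P r (m + n) \<subseteq> X"
    proof
      fix t assume "t \<in> split ` order_maps P r (m + n)"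
      then obtain g where g: "g \<in> order_maps P r (m + n)" and t: "t = split g" by auto
      note gD = order_mapsD[OF g]
      let ?I = "{p \<in> P. g p \<le> m}"
      have "order_ideal P r ?I"
        unfolding order_ideal_def using gD(4) by (auto intro: order_trans)
      moreover have "restrict g ?I \<in> order_maps ?I r m"
        using gD by (intro order_mapsI) auto
      moreover have "(\<lambda>p\<in>{p \<in> P. \<not> g p \<le> m}. g p - m) \<in> order_maps (P - ?I) r n"
      proof (rule order_mapsI)
        show "(\<lambda>p\<in>{p \<in> P. \<not> g p \<le> m}. g p - m) \<in> P - ?I \<rightarrow>\<^sub>E {1..n}"
          using gD(3) by (auto simp: PiE_iff Suc_le_eq le_diff_conv add.commute)
      qed (use gD(4) in \<open>auto simp: diff_le_mono\<close>)
      ultimately show "t \<in> X"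
        unfolding t split_def X_def by simp
    qed
  next
    show "glue ` X \<subseteq> order_maps P r (m + n)"
    proof
      fix u assume "u \<in> glue ` X"
      then obtain I f g where u: "u = glue (I, f, g)" and I: "order_ideal P r I"
        and f: "f \<in> order_maps I r m" and g: "g \<in> order_maps (P - I) r n"
        unfolding X_def by auto
      note fD = order_mapsD[OF f] and gD = order_mapsD[OF g]
      show "u \<in> order_maps P r (m + n)"
      proof (rule order_mapsI)
        show "u \<in> P \<rightarrow>\<^sub>E {1..m + n}"
          using fD(2,3) gD(2,3) by (force simp: u glue_def)
        fix p q assume pq: "p \<in> P" "q \<in> P" "(p, q) \<in> r"
        then have "q \<in> I \<Longrightarrow> p \<in> I"
          using I by (auto simp: order_ideal_def)
        then show "u p \<le> u q"
          using pq fD(3,4) gD(4) by (fastforce simp: u glue_def intro: trans_le_add2)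
      qed
    qed
  qed
  then have "card (order_maps P r (m + n)) = card X"
    by (rule bij_betw_same_card)
  also have "\<dots> = (\<Sum>I | order_ideal P r I. card (order_maps I r m \<times> order_maps (P - I) r n))"
    unfolding X_def
  proof (rule card_SigmaI)
    show "\<forall>I\<in>{I. order_ideal P r I}. finite (order_maps I r m \<times> order_maps (P - I) r n)"
      using assms by (auto simp: order_ideal_def intro!: finite_cartesian_product
          finite_order_maps intro: finite_subset)
  qed (use assms in \<open>simp add: finite_order_ideals\<close>)
  finally show ?thesis
    by (simp add: card_cartesian_product)
qed

text \<open>With \<open>m = 1\<close> in the splitting identity, the increment from \<open>n\<close>
  to \<open>n + 1\<close> is a sum of counts for the proper subsets \<open>P - I\<close> with
  \<open>I\<close> nonempty. Summing increments turns \<open>n choose k\<close> into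
  \<open>n choose Suc k\<close>, so induction on the size applies.\<close>

lemma card_order_maps_binomial:
  assumes "finite P" and "card P \<le> N"
  shows "\<exists>c. \<forall>n. card (order_maps P r n) = (\<Sum>k\<le>N. c k * (n choose k))"
  using assms
proof (induction N arbitrary: P)
  case 0
  then show ?case
    by (intro exI[of _ "\<lambda>_. 1"]) (simp add: card_order_maps_empty)
next
  case (Suc N)
  show ?case
  proof (cases "P = {}")
    case True
    have "(\<Sum>k\<le>Suc N. (if k = 0 then 1 else 0) * (n choose k)) = 1" for n :: nat
      by (subst sum.atMost_Suc_shift) simp
    then show ?thesis
      unfolding True card_order_maps_empty by metis
  next
    case False
    \<comment> \<open>The empty ideal is left out: its term is the count for \<open>P\<close> itself
      and belongs to the other side of the difference.\<close>
    let ?J = "{I. order_ideal P r I} - {{}}"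
    have ideal: "I \<subseteq> P" if "I \<in> ?J" for I
      using that by (simp add: order_ideal_def)
    have "\<forall>I\<in>?J. \<exists>c. \<forall>n. card (order_maps (P - I) r n) = (\<Sum>k\<le>N. c k * (n choose k))"
    proof
      fix I assume I: "I \<in> ?J"
      then have "card (P - I) < card P"
        using ideal[OF I] Suc.prems(1) by (intro psubset_card_mono) auto
      then show "\<exists>c. \<forall>n. card (order_maps (P - I) r n) = (\<Sum>k\<le>N. c k * (n choose k))"
        using Suc.prems by (intro Suc.IH) auto
    qed
    then obtain c where
      c: "\<And>I n. I \<in> ?J \<Longrightarrow> card (order_maps (P - I) r n) = (\<Sum>k\<le>N. c I k * (n choose k))"
      by metis
    have step: "card (order_maps P r (Suc n)) =
        card (order_maps P r n) + (\<Sum>k\<le>N. (\<Sum>I\<in>?J. c I k) * (n choose k))" for n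
    proof -
      have "card (order_maps P r (Suc n)) =
          (\<Sum>I | order_ideal P r I. card (order_maps (P - I) r n))"
        using card_order_maps_add[OF Suc.prems(1), of r 1 n] by (simp add: card_order_maps_1[simplified])
      also have "\<dots> = card (order_maps (P - {}) r n) + (\<Sum>I\<in>?J. card (order_maps (P - I) r n))"
        by (rule sum.remove) (auto simp: finite_order_ideals Suc.prems order_ideal_def)
      also have "(\<Sum>I\<in>?J. card (order_maps (P - I) r n)) =
          (\<Sum>I\<in>?J. \<Sum>k\<le>N. c I k * (n choose k))"
        using c by (rule sum.cong[OF refl])
      finally show ?thesis
        by (simp add: sum_distrib_right sum.swap[of _ _ ?J])
    qed
    \<comment> \<open>Summation moves each coefficient up by one index; the constant term is zero
      because a nonempty \<open>P\<close> has no map into \<open>{1..0}\<close>.\<close>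
    define d where "d k = (case k of 0 \<Rightarrow> 0 | Suc j \<Rightarrow> \<Sum>I\<in>?J. c I j)" for k
    have "card (order_maps P r n) = (\<Sum>k\<le>N. (\<Sum>I\<in>?J. c I k) * (n choose Suc k))" for n
    proof (induction n)
      case 0
      then show ?case by (simp add: card_order_maps_0 False)
    next
      case (Suc n)
      then show ?case
        unfolding step
        by (simp add: sum.distrib algebra_simps)
    qed
    then have "\<forall>n. card (order_maps P r n) = (\<Sum>k\<le>Suc N. d k * (n choose k))"
      by (simp add: sum.atMost_Suc_shift d_def del: sum.atMost_Suc)
    then show ?thesis
      by (rule exI[of _ d])
  qed
qed

text \<open>The defining property concerns \<open>n \<ge> 1\<close> only, but the binomial expansion
  is valid at \<open>n = 0\<close> too. The value there is needed for constant terms and for the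
  zeroth dilate.\<close>

lemma poly_order_polynomial:
  assumes "finite P"
  shows "poly (order_polynomial P r) (real n) = real (card (order_maps P r n))"
proof -
  \<comment> \<open>\<open>B k\<close> is the binomial coefficient \<open>x choose k\<close> as a
    polynomial in \<open>x\<close>.\<close>
  define B :: "nat \<Rightarrow> real poly" where
    "B k = smult (1 / fact k) (\<Prod>i<k. [:- real i, 1:])" for k
  have B: "poly (B k) (real n) = real (n choose k)" for k n
    by (simp add: B_def poly_prod binomial_gbinomial gbinomial_prod_rev lessThan_atLeast0)
  obtain c where c: "\<And>n. card (order_maps P r n) = (\<Sum>k\<le>card P. c k * (n choose k))"
    using card_order_maps_binomial[OF assms order_refl] by metis
  define f where "f = (\<Sum>k\<le>card P. smult (real (c k)) (B k))"
  have f: "poly f (real n) = real (card (order_maps P r n))" for n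
    by (simp add: f_def poly_sum B c)
  have "order_polynomial P r = f"
    unfolding order_polynomial_def
    by (rule the_equality) (auto simp: f intro!: poly_eqI_nat[of 1])
  then show ?thesis by (simp add: f)
qed

text \<open>For fixed \<open>m\<close>, the splitting identity at \<open>m + n\<close> is an
  identity of polynomials in \<open>n\<close>. Its linear coefficient is the derivative at
  \<open>m\<close> on one side and the weighted sum evaluated at \<open>m\<close> on the
  other.\<close>

lemma pderiv_order_polynomial:
  assumes "finite P"
  shows "pderiv (order_polynomial P r) =
    (\<Sum>I | order_ideal P r I. smult (coeff (order_polynomial (P - I) r) 1) (order_polynomial I r))"
proof (rule poly_eqI_nat[of 0])
  fix m :: nat
  let ?\<Omega> = "\<lambda>Q. order_polynomial Q r"
  have fin: "finite I" if "order_ideal P r I" for I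
    using that assms by (auto simp: order_ideal_def intro: finite_subset)
  have eq: "pcompose (?\<Omega> P) [:real m, 1:] =
      (\<Sum>I | order_ideal P r I. smult (poly (?\<Omega> I) (real m)) (?\<Omega> (P - I)))"
  proof (rule poly_eqI_nat[of 0])
    fix n :: nat
    have "poly (pcompose (?\<Omega> P) [:real m, 1:]) (real n) = poly (?\<Omega> P) (real (m + n))"
      by (simp add: poly_pcompose)
    also have "\<dots> = (\<Sum>I | order_ideal P r I.
        poly (?\<Omega> I) (real m) * poly (?\<Omega> (P - I)) (real n))"
      unfolding poly_order_polynomial[OF assms] card_order_maps_add[OF assms]
      by (simp add: poly_order_polynomial assms fin)
    finally show "poly (pcompose (?\<Omega> P) [:real m, 1:]) (real n) =
        poly (\<Sum>I | order_ideal P r I. smult (poly (?\<Omega> I) (real m)) (?\<Omega> (P - I))) (real n)"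
      by (simp add: poly_sum)
  qed
  have "poly (pderiv (?\<Omega> P)) (real m) = poly (pderiv (pcompose (?\<Omega> P) [:real m, 1:])) 0"
    by (simp add: pderiv_pcompose poly_pcompose pderiv_pCons)
  also have "\<dots> = coeff (pcompose (?\<Omega> P) [:real m, 1:]) 1"
    by (simp add: poly_0_coeff_0 coeff_pderiv)
  finally show "poly (pderiv (?\<Omega> P)) (real m) =
      poly (\<Sum>I | order_ideal P r I. smult (coeff (?\<Omega> (P - I)) 1) (?\<Omega> I)) (real m)"
    unfolding eq by (simp add: coeff_sum poly_sum mult.commute)
qed

section \<open>Nonnegativity of all coefficients of order polynomials in the family\<close>

locale positive_poset_family =
  fixes F :: "('a set \<times> 'a rel) set"
  assumes finite_posets: "(Q, s) \<in> F \<Longrightarrow> finite Q \<and> partial_order_on Q s"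
    and ideal_closed: "(Q, s) \<in> F \<Longrightarrow> order_ideal Q s I \<Longrightarrow> (I, Restr s I) \<in> F"
    and filter_closed: "(Q, s) \<in> F \<Longrightarrow> order_filter Q s J \<Longrightarrow> (J, Restr s J) \<in> F"
    and linear_coeff: "(Q, s) \<in> F \<Longrightarrow> 0 \<le> coeff (order_polynomial Q s) 1"
begin

lemma order_polynomial_nonneg:
  assumes "(P, r) \<in> F"
  shows "0 \<le> coeff (order_polynomial P r) i"
  using assms
proof (induction "card P" arbitrary: P r i rule: less_induct)
  case less
  have fin: "finite P" using finite_posets less.prems by blast
  show ?case
  proof (cases i)
    case 0
    \<comment> \<open>The constant term is the value at \<open>n = 0\<close>, again a
      cardinality.\<close>
    have "coeff (order_polynomial P r) 0 = real (card (order_maps P r 0))"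
      using poly_order_polynomial[OF fin, of r 0] by (simp add: poly_0_coeff_0)
    then show ?thesis by (simp add: 0)
  next
    case (Suc j)
    \<comment> \<open>The induction hypothesis does not cover \<open>I = P\<close>, but there the
      first factor is the linear coefficient of the constant polynomial 1, hence zero.\<close>
    have "0 \<le> coeff (order_polynomial (P - I) r) 1 * coeff (order_polynomial I r) j"
      if I: "order_ideal P r I" for I
    proof (cases "I = P")
      case True
      have "order_polynomial {} r = 1"
        using fin by (intro poly_eqI_nat[of 0])
          (simp add: poly_order_polynomial card_order_maps_empty)
      then show ?thesis by (simp add: True)
    next
      case False
      have IP: "I \<subseteq> P" using I by (simp add: order_ideal_def)
      then have "card I < card P" using False fin by (intro psubset_card_mono) auto
      then have "0 \<le> coeff (order_polynomial I (Restr r I)) j"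
        using less.hyps ideal_closed[OF less.prems I] by blast
      moreover have "order_filter P r (P - I)"
        using I by (auto simp: order_ideal_def order_filter_def)
      then have "0 \<le> coeff (order_polynomial (P - I) (Restr r (P - I))) 1"
        using linear_coeff filter_closed[OF less.prems] by blast
      ultimately show ?thesis
        by (simp add: order_polynomial_Restr)
    qed
    then have "0 \<le> coeff (pderiv (order_polynomial P r)) j"
      unfolding pderiv_order_polynomial[OF fin] by (auto simp: coeff_sum intro: sum_nonneg)
    then show ?thesis
      by (simp add: coeff_pderiv Suc zero_le_mult_iff)
  qed
qed

end

section \<open>Level sets and the lattice points of a single box\<close>

lemma card_order_maps_fibres:
  assumes "finite W"
  shows "card (order_maps W {(p, q) \<in> r. h p = h q} n) =
    (\<Prod>k\<in>h ` W. card (order_maps {p \<in> W. h p = k} r n))"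
proof -
  \<comment> \<open>Without relations across level sets of \<open>h\<close>, an order preserving map
    is an independent choice on each level set.\<close>
  define X where "X = (\<Pi>\<^sub>E k\<in>h ` W. order_maps {p \<in> W. h p = k} r n)"
  define split where "split = (\<lambda>g :: 'a \<Rightarrow> nat. \<lambda>k\<in>h ` W. restrict g {p \<in> W. h p = k})"
  define glue where "glue = (\<lambda>G. \<lambda>p\<in>W. G (h p) p :: nat)"
  have "bij_betw split (order_maps W {(p, q) \<in> r. h p = h q} n) X"
  proof (rule bij_betw_byWitness[where f' = glue])
    show "\<forall>g\<in>order_maps W {(p, q) \<in> r. h p = h q} n. glue (split g) = g"
      unfolding glue_def split_def order_maps_def
      by (auto simp: fun_eq_iff PiE_iff extensional_def)
  next
    show "\<forall>G\<in>X. split (glue G) = G"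
    proof
      fix G assume G: "G \<in> X"
      have "restrict (glue G) {p \<in> W. h p = k} = G k" if "k \<in> h ` W" for k
      proof -
        have "G k \<in> order_maps {p \<in> W. h p = k} r n"
          using G that unfolding X_def by blast
        from order_mapsD(1)[OF this] show ?thesis
          by (auto simp: glue_def fun_eq_iff PiE_iff extensional_def)
      qed
      moreover have "G \<in> extensional (h ` W)"
        using G by (simp add: X_def PiE_iff)
      ultimately show "split (glue G) = G"
        unfolding split_def by (intro extensionalityI[of _ "h ` W"]) auto
    qed
  next
    show "split ` order_maps W {(p, q) \<in> r. h p = h q} n \<subseteq> X"
    proof
      fix G assume "G \<in> split ` order_maps W {(p, q) \<in> r. h p = h q} n"
      then obtain g where g: "g \<in> order_maps W {(p, q) \<in> r. h p = h q} n" and G: "G = split g"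
        by auto
      have "restrict g {p \<in> W. h p = k} \<in> order_maps {p \<in> W. h p = k} r n" for k
        using order_mapsD[OF g] by (intro order_mapsI) auto
      then show "G \<in> X"
        unfolding G X_def split_def by auto
    qed
  next
    show "glue ` X \<subseteq> order_maps W {(p, q) \<in> r. h p = h q} n"
    proof
      fix g assume "g \<in> glue ` X"
      then obtain G where "G \<in> X" and g: "g = glue G" by auto
      then have G: "G (h p) \<in> order_maps {q \<in> W. h q = h p} r n" if "p \<in> W" for p
        using that unfolding X_def by auto
      show "g \<in> order_maps W {(p, q) \<in> r. h p = h q} n"
      proof (rule order_mapsI)
        show "g \<in> W \<rightarrow>\<^sub>E {1..n}"
          using order_mapsD(2,3)[OF G] by (auto simp: g glue_def)
        fix p q assume "p \<in> W" "q \<in> W" "(p, q) \<in> {(p, q) \<in> r. h p = h q}"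
        then show "g p \<le> g q"
          using order_mapsD(4)[OF G, of q p q] by (simp add: g glue_def)
      qed
    qed
  qed
  then have "card (order_maps W {(p, q) \<in> r. h p = h q} n) = card X"
    by (rule bij_betw_same_card)
  also have "\<dots> = (\<Prod>k\<in>h ` W. card (order_maps {p \<in> W. h p = k} r n))"
    unfolding X_def using assms by (intro card_PiE) simp
  finally show ?thesis .
qed

text \<open>For \<open>A \<subseteq> P\<close> and \<open>n > 0\<close> these correspond to the
  lattice points of the \<open>n\<close>-th dilate, kept integer-valued so that integer division
  applies. At \<open>n = 0\<close> the zero map belongs to the set even if the polytope is
  empty.\<close>

definition marked_maps ::
    "'a set \<Rightarrow> 'a rel \<Rightarrow> 'a set \<Rightarrow> ('a \<Rightarrow> int) \<Rightarrow> nat \<Rightarrow> ('a \<Rightarrow> int) set" where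
  "marked_maps P r A lam n =
     {g \<in> P \<rightarrow>\<^sub>E UNIV. order_preserving P r g \<and> (\<forall>a\<in>A. g a = int n * lam a)}"

definition unforced :: "'a set \<Rightarrow> 'a rel \<Rightarrow> 'a set \<Rightarrow> ('a \<Rightarrow> int) \<Rightarrow> 'a set" where
  "unforced P r A h = {p \<in> P. \<forall>a\<in>A. (a, p) \<in> r \<longrightarrow> h a \<noteq> h p}"

text \<open>Subtracting \<open>int n * (h p - 1)\<close> turns the half-open interval at an unforced
  \<open>p\<close> into \<open>{1..n}\<close>; forced elements sit at the top of their intervals.
  Relations between different values of \<open>h\<close> hold automatically in the box and are
  therefore dropped.\<close>

lemma marked_maps_fibre:
  assumes "finite P" and refl: "refl_on P r" and "trans r" and "A \<subseteq> P" and "0 < n"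
    and h: "h \<in> marked_maps P r A lam 1"
  shows "card {g \<in> marked_maps P r A lam n. \<forall>p\<in>P. int n * (h p - 1) < g p \<and> g p \<le> int n * h p} =
    card (order_maps (unforced P r A h) {(p, q) \<in> r. h p = h q} n)"
    (is "card ?G = card (order_maps ?W ?r n)")
proof -
  have h_mono: "h p \<le> h q" if "(p, q) \<in> r" "p \<in> P" "q \<in> P" for p q
    using h that by (auto simp: marked_maps_def dest: order_preservingD)
  have h_lam: "h a = lam a" if "a \<in> A" for a
    using h that by (auto simp: marked_maps_def)
  have WP: "?W \<subseteq> P" by (auto simp: unforced_def)
  define drop where "drop = (\<lambda>g. \<lambda>p\<in>?W. nat (g p - int n * (h p - 1)))"
  define lift where "lift = (\<lambda>f. \<lambda>p\<in>P. if p \<in> ?W then int n * (h p - 1) + int (f p) else int n * h p)"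
  \<comment> \<open>The forcing mark bounds \<open>g p\<close> from below by the same number that
    bounds it from above in the box.\<close>
  have forced: "g p = int n * h p" if "g \<in> ?G" "p \<in> P" "p \<notin> ?W" for g p
  proof -
    obtain a where a: "a \<in> A" "(a, p) \<in> r" "h a = h p"
      using \<open>p \<in> P\<close> \<open>p \<notin> ?W\<close> by (auto simp: unforced_def)
    then have "g a \<le> g p" "g a = int n * lam a"
      using \<open>g \<in> ?G\<close> \<open>A \<subseteq> P\<close> \<open>p \<in> P\<close> by (auto simp: marked_maps_def dest: order_preservingD)
    then have "int n * h p \<le> g p"
      using h_lam[OF a(1)] a(3) by simp
    moreover have "g p \<le> int n * h p"
      using \<open>g \<in> ?G\<close> \<open>p \<in> P\<close> by auto
    ultimately show ?thesis by simp
  qed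
  have "bij_betw drop ?G (order_maps ?W ?r n)"
  proof (rule bij_betw_byWitness[where f' = lift])
    show "\<forall>g\<in>?G. lift (drop g) = g"
    proof
      fix g assume g: "g \<in> ?G"
      have "lift (drop g) p = g p" for p
      proof (cases "p \<in> P")
        case True
        then have "int n * (h p - 1) < g p" using g by auto
        then show ?thesis
          using True forced[OF g True] by (simp add: lift_def drop_def)
      next
        case False
        then show ?thesis using g by (auto simp: lift_def marked_maps_def PiE_iff extensional_def)
      qed
      then show "lift (drop g) = g" by blast
    qed
  next
    show "\<forall>f\<in>order_maps ?W ?r n. drop (lift f) = f"
    proof
      fix f assume "f \<in> order_maps ?W ?r n"
      then have "f \<in> extensional ?W"
        by (simp add: order_maps_def PiE_iff)
      then show "drop (lift f) = f"
        using WP by (intro extensionalityI[of _ ?W]) (auto simp: drop_def lift_def)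
    qed
  next
    show "drop ` ?G \<subseteq> order_maps ?W ?r n"
    proof
      fix f assume "f \<in> drop ` ?G"
      then obtain g where g: "g \<in> ?G" and f: "f = drop g" by auto
      have bounds: "int n * (h p - 1) < g p" "g p \<le> int n * h p" if "p \<in> ?W" for p
        using g that WP by auto
      show "f \<in> order_maps ?W ?r n"
      proof (rule order_mapsI)
        show "f \<in> ?W \<rightarrow>\<^sub>E {1..n}"
          using bounds by (fastforce simp: f drop_def nat_le_iff algebra_simps)
        fix p q assume "p \<in> ?W" "q \<in> ?W" "(p, q) \<in> ?r"
        then show "f p \<le> f q"
          using g WP by (auto simp: f drop_def marked_maps_def intro!: nat_mono
              dest: order_preservingD)
      qed
    qed
  next
    show "lift ` order_maps ?W ?r n \<subseteq> ?G"
    proof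
      fix g assume "g \<in> lift ` order_maps ?W ?r n"
      then obtain f where f: "f \<in> order_maps ?W ?r n" and g: "g = lift f" by auto
      note fD = order_mapsD[OF f]
      have bounds: "int n * (h p - 1) < g p" "g p \<le> int n * h p" if "p \<in> P" for p
        using that fD(2,3)[of p] \<open>0 < n\<close> by (auto simp: g lift_def algebra_simps)
      have "order_preserving P r g"
      proof (rule order_preservingI)
        fix p q assume pq: "p \<in> P" "q \<in> P" "(p, q) \<in> r"
        show "g p \<le> g q"
        proof (cases "h p = h q")
          case True
          \<comment> \<open>Within a level set, a mark forcing \<open>p\<close> also forces
            \<open>q\<close>. So if \<open>q\<close> is unforced, monotonicity of \<open>f\<close>
            decides; if \<open>q\<close> is forced, \<open>g q\<close> is the top of the common
            interval.\<close>
          have "p \<in> ?W" if "q \<in> ?W"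
          proof -
            have "h a \<noteq> h p" if "a \<in> A" "(a, p) \<in> r" for a
              using that \<open>q \<in> ?W\<close> True transD[OF \<open>trans r\<close> that(2) pq(3)]
              by (auto simp: unforced_def)
            then show ?thesis
              using pq(1) by (simp add: unforced_def)
          qed
          then show ?thesis
            using pq True fD(4)[of p q] bounds(2)[OF pq(1)] by (auto simp: g lift_def)
        next
          case False
          \<comment> \<open>Distinct integer levels differ by at least one, so the interval of
            \<open>p\<close> ends no later than the excluded left end of that of
            \<open>q\<close>.\<close>
          then have "h p \<le> h q - 1" using h_mono pq by fastforce
          then have "int n * h p \<le> int n * (h q - 1)" by (simp add: mult_left_mono)
          then show ?thesis using bounds(2)[OF pq(1)] bounds(1)[OF pq(2)] by linarith
        qed
      qed
      moreover have "g a = int n * lam a" if "a \<in> A" for a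
      proof -
        \<comment> \<open>By reflexivity a marked element forces itself.\<close>
        have "a \<notin> ?W"
          using that \<open>A \<subseteq> P\<close> refl_onD[OF refl] by (auto simp: unforced_def)
        then show ?thesis using that \<open>A \<subseteq> P\<close> h_lam by (auto simp: g lift_def)
      qed
      moreover have "g \<in> P \<rightarrow>\<^sub>E UNIV" by (simp add: g lift_def)
      ultimately show "g \<in> ?G"
        using bounds by (simp add: marked_maps_def)
    qed
  qed
  then show ?thesis by (rule bij_betw_same_card)
qed

section \<open>Extremal elements, finiteness, and the partition of a dilate into boxes\<close>

lemma min_element_below:
  assumes "finite P" and "partial_order_on P r" and "p \<in> P"
  shows "\<exists>a\<in>min_elements P r. (a, p) \<in> r"
  using \<open>p \<in> P\<close>
proof (induction "card {q \<in> P. (q, p) \<in> r}" arbitrary: p rule: less_induct)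
  case less
  have order: "refl_on P r" "trans r" "antisym r"
    using assms(2) by (auto simp: partial_order_on_def preorder_on_def)
  show ?case
  proof (cases "p \<in> min_elements P r")
    case True
    then show ?thesis using refl_onD[OF order(1) less.prems] by blast
  next
    case False
    then obtain q where q: "q \<in> P" "(q, p) \<in> r" "q \<noteq> p"
      using less.prems by (auto simp: min_elements_def)
    \<comment> \<open>Passing to a strictly smaller \<open>q\<close> shrinks the principal ideal,
      since antisymmetry expels \<open>p\<close> from it.\<close>
    have "{s \<in> P. (s, q) \<in> r} \<subseteq> {s \<in> P. (s, p) \<in> r}"
      using transD[OF order(2) _ q(2)] by auto
    moreover have "p \<notin> {s \<in> P. (s, q) \<in> r}" "p \<in> {s \<in> P. (s, p) \<in> r}"
      using antisymD[OF order(3) q(2)] q(3) refl_onD[OF order(1)] less.prems by auto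
    ultimately have "card {s \<in> P. (s, q) \<in> r} < card {s \<in> P. (s, p) \<in> r}"
      using \<open>finite P\<close> by (intro psubset_card_mono) auto
    then obtain a where "a \<in> min_elements P r" "(a, q) \<in> r"
      using less.hyps q(1) by blast
    then show ?thesis
      using transD[OF order(2) _ q(2)] by blast
  qed
qed

lemma max_element_above:
  assumes "finite P" and "partial_order_on P r" and "p \<in> P"
  shows "\<exists>a\<in>max_elements P r. (p, a) \<in> r"
  using min_element_below[OF assms(1) _ assms(3), of "r\<inverse>"] assms(2)
  by (simp add: min_elements_def max_elements_def)

text \<open>Every element lies between a marked minimal and a marked maximal element, which confines
  all values to the range of the scaled marks.\<close>

lemma finite_marked_maps:
  assumes "finite P" and "partial_order_on P r" and "A \<subseteq> P"
    and "min_elements P r \<union> max_elements P r \<subseteq> A"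
  shows "finite (marked_maps P r A lam n)"
proof -
  have fin: "finite ((\<lambda>a. int n * lam a) ` A)"
    using assms(1,3) finite_subset by blast
  let ?l = "Min ((\<lambda>a. int n * lam a) ` A)" and ?u = "Max ((\<lambda>a. int n * lam a) ` A)"
  have "marked_maps P r A lam n \<subseteq> P \<rightarrow>\<^sub>E {?l..?u}"
  proof
    fix g assume g: "g \<in> marked_maps P r A lam n"
    have "?l \<le> g p \<and> g p \<le> ?u" if p: "p \<in> P" for p
    proof -
      obtain a b where ab: "a \<in> A" "(a, p) \<in> r" "b \<in> A" "(p, b) \<in> r"
        using min_element_below[OF assms(1,2) p] max_element_above[OF assms(1,2) p] assms(4)
        by blast
      then have "g a \<le> g p" "g p \<le> g b" "g a = int n * lam a" "g b = int n * lam b"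
        using g p assms(3) by (auto simp: marked_maps_def dest: order_preservingD)
      moreover have "?l \<le> int n * lam a" "int n * lam b \<le> ?u"
        by (rule Min_le[OF fin imageI[OF ab(1)]], rule Max_ge[OF fin imageI[OF ab(3)]])
      ultimately show ?thesis by linarith
    qed
    then show "g \<in> P \<rightarrow>\<^sub>E {?l..?u}"
      using g by (auto simp: marked_maps_def)
  qed
  then show ?thesis
    by (rule finite_subset) (simp add: finite_PiE assms(1))
qed

text \<open>The boxes of the lattice points \<open>h\<close> partition the lattice points of the
  dilate: \<open>g\<close> lies in the box of \<open>g / n\<close> rounded up. Rounding is monotone
  and exact on the marks, which are multiples of \<open>n\<close>.\<close>

lemma card_marked_maps:
  assumes "finite P" and "refl_on P r" and "trans r" and "A \<subseteq> P" and "0 < n"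
    and fin: "finite (marked_maps P r A lam 1)" "finite (marked_maps P r A lam n)"
  shows "card (marked_maps P r A lam n) =
    (\<Sum>h\<in>marked_maps P r A lam 1. \<Prod>k\<in>h ` unforced P r A h.
      card (order_maps {p \<in> unforced P r A h. h p = k} r n))"
proof -
  let ?M = "marked_maps P r A lam"
  define box where "box h g \<longleftrightarrow> (\<forall>p\<in>P. int n * (h p - 1) < g p \<and> g p \<le> int n * h p)"
    for h g :: "'a \<Rightarrow> int"
  \<comment> \<open>\<open>c g\<close> is the ceiling of \<open>g / n\<close>, expressed through
    integer division, which rounds down.\<close>
  define c where "c g = (\<lambda>p\<in>P. - ((- g p) div int n))" for g :: "'a \<Rightarrow> int"
  \<comment> \<open>The index of an interval containing \<open>z\<close> must be the ceiling of
    \<open>z / n\<close>; hence distinct boxes are disjoint.\<close>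
  have box: "k = - ((- z) div int n)" if "int n * (k - 1) < z" "z \<le> int n * k" for k z
  proof -
    have "(- z) div int n = - k"
      using that \<open>0 < n\<close> by (intro int_div_pos_eq[where r = "int n * k - z"]) (auto simp: algebra_simps)
    then show ?thesis by simp
  qed
  have "?M n = (\<Union>h\<in>?M 1. {g \<in> ?M n. box h g})"
  proof (intro equalityI subsetI)
    fix g assume g: "g \<in> ?M n"
    have "c g \<in> ?M 1"
    proof -
      have "order_preserving P r (c g)"
        using g \<open>0 < n\<close> by (intro order_preservingI)
          (auto simp: c_def marked_maps_def zdiv_mono1 dest: order_preservingD)
      moreover have "c g a = lam a" if "a \<in> A" for a
        using that g \<open>A \<subseteq> P\<close> \<open>0 < n\<close> by (auto simp: c_def marked_maps_def simp flip: mult_minus_right)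
      ultimately show ?thesis by (simp add: marked_maps_def c_def)
    qed
    moreover have "box (c g) g"
      unfolding box_def
    proof
      fix p assume "p \<in> P"
      let ?t = "int n * ((- g p) div int n)"
      have "?t + (- g p) mod int n = - g p"
        by simp
      moreover have "0 \<le> (- g p) mod int n" "(- g p) mod int n < int n"
        using \<open>0 < n\<close> by simp_all
      moreover have "int n * c g p = - ?t" "int n * (c g p - 1) = - ?t - int n"
        using \<open>p \<in> P\<close> by (simp_all add: c_def right_diff_distrib)
      ultimately show "int n * (c g p - 1) < g p \<and> g p \<le> int n * c g p"
        by linarith
    qed
    ultimately show "g \<in> (\<Union>h\<in>?M 1. {g \<in> ?M n. box h g})"
      using g by blast
  qed auto
  then have "card (?M n) = card (\<Union>h\<in>?M 1. {g \<in> ?M n. box h g})"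
    by simp
  also have "\<dots> = (\<Sum>h\<in>?M 1. card {g \<in> ?M n. box h g})"
  proof (rule card_UN_disjoint)
    show "\<forall>h\<in>?M 1. \<forall>h'\<in>?M 1. h \<noteq> h' \<longrightarrow> {g \<in> ?M n. box h g} \<inter> {g \<in> ?M n. box h' g} = {}"
    proof (intro ballI impI, rule ccontr)
      fix h h' assume hh': "h \<in> ?M 1" "h' \<in> ?M 1" "h \<noteq> h'"
        and "{g \<in> ?M n. box h g} \<inter> {g \<in> ?M n. box h' g} \<noteq> {}"
      then obtain g where g: "box h g" "box h' g" by blast
      have "h p = h' p" if "p \<in> P" for p
        using g that box[of "h p" "g p"] box[of "h' p" "g p"] by (simp add: box_def)
      then have "h = h'"
        using hh' by (intro extensionalityI[of _ P]) (auto simp: marked_maps_def PiE_iff)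
      then show False using hh' by simp
    qed
  qed (use fin in auto)
  also have "\<dots> = (\<Sum>h\<in>?M 1. \<Prod>k\<in>h ` unforced P r A h.
      card (order_maps {p \<in> unforced P r A h. h p = k} r n))"
  proof (rule sum.cong[OF refl])
    fix h assume "h \<in> ?M 1"
    then have "card {g \<in> ?M n. box h g} =
        card (order_maps (unforced P r A h) {(p, q) \<in> r. h p = h q} n)"
      unfolding box_def using assms by (intro marked_maps_fibre) auto
    also have "\<dots> = (\<Prod>k\<in>h ` unforced P r A h.
        card (order_maps {p \<in> unforced P r A h. h p = k} r n))"
      using \<open>finite P\<close> by (intro card_order_maps_fibres) (auto simp: unforced_def)
    finally show "card {g \<in> ?M n. box h g} = \<dots>" .
  qed
  finally show ?thesis .
qed

text \<open>At \<open>n = 0\<close> the sum in \<open>card_marked_maps\<close> counts the points without unforced elements.\<close>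

lemma unique_fully_forced:
  assumes "finite P" and order: "partial_order_on P r" and "A \<subseteq> P"
    and "min_elements P r \<subseteq> A"
    and ne: "marked_maps P r A lam 1 \<noteq> {}"
  shows "\<exists>!h. h \<in> marked_maps P r A lam 1 \<and> unforced P r A h = {}"
proof -
  have refl: "refl_on P r" and trans: "trans r"
    using order by (auto simp: partial_order_on_def preorder_on_def)
  define B where "B p = {a \<in> A. (a, p) \<in> r}" for p
  have fin: "finite (B p)" for p
    using finite_subset[OF assms(3,1)] by (simp add: B_def)
  have B_ne: "B p \<noteq> {}" if "p \<in> P" for p
    using min_element_below[OF assms(1,2) that] assms(4) by (auto simp: B_def)
  have lam_le: "lam a \<le> h p" if "h \<in> marked_maps P r A lam 1" "a \<in> B p" "p \<in> P" for h a p
    using that \<open>A \<subseteq> P\<close> order_preservingD[of P r h a p] by (auto simp: marked_maps_def B_def)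
  \<comment> \<open>Each \<open>p\<close> receives the largest mark below it, which exists because
    minimal elements are marked. This is a lower bound for every lattice point.\<close>
  define h\<^sub>0 where "h\<^sub>0 = (\<lambda>p\<in>P. Max (lam ` B p))"
  obtain h\<^sub>1 where h\<^sub>1: "h\<^sub>1 \<in> marked_maps P r A lam 1" using ne by blast
  \<comment> \<open>The point \<open>h\<^sub>1\<close> witnesses that \<open>lam\<close> is monotone
    on \<open>A\<close>, so the largest mark below \<open>a\<close> is \<open>lam a\<close>
    itself.\<close>
  have h\<^sub>0_A: "h\<^sub>0 a = lam a" if "a \<in> A" for a
  proof -
    have "Max (lam ` B a) = lam a"
    proof (rule Max_eqI)
      show "y \<le> lam a" if "y \<in> lam ` B a" for y
        using that lam_le[OF h\<^sub>1] h\<^sub>1 \<open>a \<in> A\<close> \<open>A \<subseteq> P\<close> by (fastforce simp: marked_maps_def)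
      show "lam a \<in> lam ` B a"
        using that \<open>A \<subseteq> P\<close> refl_onD[OF refl] by (auto simp: B_def)
    qed (simp add: fin)
    then show ?thesis using that \<open>A \<subseteq> P\<close> by (auto simp: h\<^sub>0_def)
  qed
  have "order_preserving P r h\<^sub>0"
  proof (rule order_preservingI)
    fix p q assume pq: "p \<in> P" "q \<in> P" "(p, q) \<in> r"
    have "B p \<subseteq> B q"
      using transD[OF trans _ pq(3)] by (auto simp: B_def)
    then have "Max (lam ` B p) \<le> Max (lam ` B q)"
      using B_ne[OF pq(1)] fin by (intro Max_mono) auto
    then show "h\<^sub>0 p \<le> h\<^sub>0 q" using pq by (simp add: h\<^sub>0_def)
  qed
  then have mem: "h\<^sub>0 \<in> marked_maps P r A lam 1"
    using h\<^sub>0_A by (auto simp: marked_maps_def h\<^sub>0_def)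
  have "unforced P r A h\<^sub>0 = {}"
  proof -
    have "\<exists>a\<in>A. (a, p) \<in> r \<and> h\<^sub>0 a = h\<^sub>0 p" if "p \<in> P" for p
    proof -
      have "Max (lam ` B p) \<in> lam ` B p"
        using B_ne[OF that] fin by (intro Max_in) auto
      then obtain a where "a \<in> B p" "Max (lam ` B p) = lam a" by auto
      then show ?thesis
        using that h\<^sub>0_A by (auto simp: B_def h\<^sub>0_def)
    qed
    then show ?thesis by (auto simp: unforced_def)
  qed
  \<comment> \<open>A fully forced \<open>h\<close> takes at \<open>p\<close> the value of a mark
    below \<open>p\<close>, and all such marks are lower bounds for \<open>h p\<close>.\<close>
  moreover have "h = h\<^sub>0" if h: "h \<in> marked_maps P r A lam 1" and forced: "unforced P r A h = {}" for h
  proof (rule extensionalityI[of _ P])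
    fix p assume p: "p \<in> P"
    obtain a where a: "a \<in> A" "(a, p) \<in> r" "h a = h p"
      using forced p by (auto simp: unforced_def)
    have "Max (lam ` B p) = h p"
    proof (rule Max_eqI)
      show "y \<le> h p" if "y \<in> lam ` B p" for y
        using that lam_le[OF h _ p] by auto
      show "h p \<in> lam ` B p"
        using a h by (force simp: B_def marked_maps_def)
    qed (simp add: fin)
    then show "h p = h\<^sub>0 p" using p by (simp add: h\<^sub>0_def)
  qed (use h in \<open>auto simp: marked_maps_def h\<^sub>0_def PiE_iff\<close>)
  ultimately show ?thesis using mem by blast
qed

section \<open>Convex hulls, dilates, and integrality of the polytope\<close>

lemma convex_hull_on_empty: "convex_hull_on S {} = {}"
  by (simp add: convex_hull_on_def)

lemma convex_hull_on_inc:
  assumes "finite V" and "v \<in> V" and "v \<in> S \<rightarrow>\<^sub>E UNIV"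
  shows "v \<in> convex_hull_on S V"
proof -
  let ?c = "\<lambda>u. if u = v then 1 else 0 :: real"
  have "(\<Sum>u\<in>V. ?c u * u s) = v s" for s
    using assms by (simp add: if_distrib[of "\<lambda>x. x * _"] sum.delta' cong: if_cong)
  then have "v = (\<lambda>s\<in>S. \<Sum>u\<in>V. ?c u * u s)"
    using assms(3) by (auto simp: fun_eq_iff PiE_iff extensional_def)
  moreover have "\<forall>u\<in>V. 0 \<le> ?c u" "(\<Sum>u\<in>V. ?c u) = 1"
    using assms by (auto simp: sum.delta')
  ultimately show ?thesis
    unfolding convex_hull_on_def by (intro CollectI exI[of _ ?c]) auto
qed

lemma convex_hull_on_segment:
  assumes "x \<in> convex_hull_on S V" and "y \<in> convex_hull_on S V" and "0 \<le> t" and "t \<le> 1"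
  shows "(\<lambda>s\<in>S. (1 - t) * x s + t * y s) \<in> convex_hull_on S V"
proof -
  obtain c where c: "\<forall>v\<in>V. 0 \<le> c v" "(\<Sum>v\<in>V. c v) = 1" "x = (\<lambda>s\<in>S. \<Sum>v\<in>V. c v * v s)"
    using assms(1) by (auto simp: convex_hull_on_def)
  obtain d where d: "\<forall>v\<in>V. 0 \<le> d v" "(\<Sum>v\<in>V. d v) = 1" "y = (\<lambda>s\<in>S. \<Sum>v\<in>V. d v * v s)"
    using assms(2) by (auto simp: convex_hull_on_def)
  let ?e = "\<lambda>v. (1 - t) * c v + t * d v"
  have "\<forall>v\<in>V. 0 \<le> ?e v"
    using c(1) d(1) assms(3,4) by simp
  moreover have "(\<Sum>v\<in>V. ?e v) = 1"
    by (simp add: sum.distrib c(2) d(2) flip: sum_distrib_left)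
  moreover have "(\<lambda>s\<in>S. (1 - t) * x s + t * y s) = (\<lambda>s\<in>S. \<Sum>v\<in>V. ?e v * v s)"
    unfolding c(3) d(3)
    by (rule restrict_ext) (simp add: sum_distrib_left distrib_right sum.distrib mult.assoc)
  ultimately show ?thesis
    unfolding convex_hull_on_def by (intro CollectI exI[of _ ?e]) auto
qed

text \<open>Division by a positive \<open>n\<close> takes an integer map with scaled marks back into
  the polytope; conversely \<open>floor\<close> recovers the integer coordinates unchanged.\<close>

lemma lattice_points_dilate:
  assumes "A \<subseteq> P" and "0 < n"
  shows "dilate P n (marked_order_polytope P r A lam) \<inter> (P \<rightarrow>\<^sub>E \<int>) =
    (\<lambda>g. \<lambda>p\<in>P. real_of_int (g p)) ` marked_maps P r A lam n"
    (is "?L = ?emb ` ?M")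
proof (intro equalityI subsetI)
  fix y assume y: "y \<in> ?L"
  then obtain x where x: "x \<in> marked_order_polytope P r A lam" "y = (\<lambda>p\<in>P. real n * x p)"
    by (auto simp: dilate_def)
  have int: "real_of_int \<lfloor>y p\<rfloor> = y p" if "p \<in> P" for p
    using y that by (auto simp: PiE_iff)
  have "order_preserving P r (\<lambda>p\<in>P. \<lfloor>y p\<rfloor>)"
    using x by (intro order_preservingI)
      (auto simp: marked_order_polytope_def intro!: floor_mono mult_left_mono dest: order_preservingD)
  moreover have "\<lfloor>y a\<rfloor> = int n * lam a" if "a \<in> A" for a
  proof -
    have "y a = real_of_int (int n * lam a)"
      using x that assms(1) by (auto simp: marked_order_polytope_def)
    then show ?thesis by (simp only: floor_of_int)
  qed
  ultimately have "(\<lambda>p\<in>P. \<lfloor>y p\<rfloor>) \<in> ?M"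
    using assms(1) by (auto simp: marked_maps_def)
  moreover have "y = ?emb (\<lambda>p\<in>P. \<lfloor>y p\<rfloor>)"
    using int y by (auto simp: fun_eq_iff PiE_iff extensional_def)
  ultimately show "y \<in> ?emb ` ?M" by blast
next
  fix y assume "y \<in> ?emb ` ?M"
  then obtain g where g: "g \<in> ?M" "y = ?emb g" by auto
  have "(\<lambda>p\<in>P. g p / real n) \<in> marked_order_polytope P r A lam"
    using g(1) assms order_preservingD[of P r g]
    by (auto simp: marked_order_polytope_def marked_maps_def intro!: order_preservingI
        divide_right_mono)
  moreover have "y = (\<lambda>p\<in>P. real n * (\<lambda>p\<in>P. g p / real n) p)"
    using assms(2) by (auto simp: g(2) fun_eq_iff)
  ultimately have "y \<in> dilate P n (marked_order_polytope P r A lam)"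
    unfolding dilate_def by blast
  then show "y \<in> ?L" by (simp add: g(2) PiE_iff)
qed

lemma dilate_1:
  assumes "Q \<subseteq> S \<rightarrow>\<^sub>E UNIV"
  shows "dilate S 1 Q = Q"
proof -
  have "(\<lambda>s\<in>S. real 1 * x s) = x" if "x \<in> Q" for x
    using that assms by (auto simp: fun_eq_iff PiE_iff extensional_def)
  then show ?thesis by (simp add: dilate_def)
qed

lemma dilate_0: "Q \<noteq> {} \<Longrightarrow> dilate S 0 Q = {\<lambda>s\<in>S. 0}"
  by (auto simp: dilate_def)

text \<open>
  A non-integral point of the polytope is an interior point of a segment obtained by shifting all
  its non-integral coordinates simultaneously, down until the first of them becomes an integer and
  likewise up.
\<close>

lemma marked_order_polytope_subset_hull:
  assumes "finite P" and "A \<subseteq> P"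
    and fin: "finite (marked_order_polytope P r A lam \<inter> (P \<rightarrow>\<^sub>E \<int>))"
    and "x \<in> marked_order_polytope P r A lam"
  shows "x \<in> convex_hull_on P (marked_order_polytope P r A lam \<inter> (P \<rightarrow>\<^sub>E \<int>))"
  using assms(4)
proof (induction "card {p \<in> P. x p \<notin> \<int>}" arbitrary: x rule: less_induct)
  case less
  let ?Q = "marked_order_polytope P r A lam"
  define N where "N = {p \<in> P. x p \<notin> \<int>}"
  have x: "x \<in> P \<rightarrow>\<^sub>E UNIV" "order_preserving P r x" "\<And>a. a \<in> A \<Longrightarrow> x a = of_int (lam a)"
    using less.prems by (auto simp: marked_order_polytope_def)
  have finN: "finite N" using \<open>finite P\<close> by (simp add: N_def)
  show ?case
  proof (cases "N = {}")
    case True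
    then have "x \<in> ?Q \<inter> (P \<rightarrow>\<^sub>E \<int>)"
      using less.prems x(1) by (auto simp: N_def PiE_iff)
    then show ?thesis by (rule convex_hull_on_inc[OF fin _ x(1)])
  next
    case False
    define shift where "shift s = (\<lambda>p\<in>P. if p \<in> N then x p + s else x p)" for s
    \<comment> \<open>Keeping each non-integral coordinate between its neighbouring integers
      preserves its order relative to the integral ones, and the common shift preserves the order
      among the rest. Since \<open>p\<^sub>0\<close> becomes integral, the induction hypothesis
      applies.\<close>
    have shift_hull: "shift s \<in> convex_hull_on P (?Q \<inter> (P \<rightarrow>\<^sub>E \<int>))"
      if s: "\<And>p. p \<in> N \<Longrightarrow> of_int \<lfloor>x p\<rfloor> \<le> x p + s" "\<And>p. p \<in> N \<Longrightarrow> x p + s \<le> of_int \<lfloor>x p\<rfloor> + 1"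
        and p\<^sub>0: "p\<^sub>0 \<in> N" "x p\<^sub>0 + s \<in> \<int>" for s p\<^sub>0
    proof (rule less.hyps)
      have "{p \<in> P. shift s p \<notin> \<int>} \<subseteq> N - {p\<^sub>0}"
        using p\<^sub>0 by (auto simp: shift_def N_def)
      then have "{p \<in> P. shift s p \<notin> \<int>} \<subset> N" using p\<^sub>0(1) by blast
      then show "card {p \<in> P. shift s p \<notin> \<int>} < card {p \<in> P. x p \<notin> \<int>}"
        using psubset_card_mono[OF finN] by (simp add: N_def)
      have "order_preserving P r (shift s)"
      proof (rule order_preservingI)
        fix p q assume pq: "p \<in> P" "q \<in> P" "(p, q) \<in> r"
        then have le: "x p \<le> x q" using x(2) by (auto dest: order_preservingD)
        consider "p \<in> N \<longleftrightarrow> q \<in> N" | "p \<in> N" "q \<notin> N" | "p \<notin> N" "q \<in> N" by blast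
        then show "shift s p \<le> shift s q"
        proof cases
          case 1
          then show ?thesis using le pq by (simp add: shift_def)
        next
          case 2
          then obtain k where k: "x q = of_int k" using pq by (auto simp: N_def elim: Ints_cases)
          have "x p \<noteq> of_int k" using 2 by (auto simp: N_def)
          then have "\<lfloor>x p\<rfloor> < k" using le k by (simp add: floor_less_iff)
          then have "of_int \<lfloor>x p\<rfloor> + 1 \<le> (of_int k :: real)" by linarith
          then show ?thesis using 2 s(2)[of p] k pq by (simp add: shift_def)
        next
          case 3
          then obtain k where k: "x p = of_int k" using pq by (auto simp: N_def elim: Ints_cases)
          then have "of_int k \<le> (of_int \<lfloor>x q\<rfloor> :: real)" using le by (simp add: le_floor_iff)
          then show ?thesis using 3 s(1)[of q] k pq by (simp add: shift_def)
        qed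
      qed
      then show "shift s \<in> ?Q"
        using x(3) \<open>A \<subseteq> P\<close> by (auto simp: marked_order_polytope_def shift_def N_def)
    qed
    \<comment> \<open>\<open>c\<close> is the largest step down and \<open>1 - C\<close> the largest
      step up before some coordinate would pass an integer; both are positive and attained.\<close>
    define c C where "c = Min ((\<lambda>p. frac (x p)) ` N)" and "C = Max ((\<lambda>p. frac (x p)) ` N)"
    have "c \<in> (\<lambda>p. frac (x p)) ` N" "C \<in> (\<lambda>p. frac (x p)) ` N"
      unfolding c_def C_def using False finN by (auto intro!: Min_in Max_in)
    then obtain p\<^sub>c p\<^sub>C where p: "p\<^sub>c \<in> N" "c = frac (x p\<^sub>c)" "p\<^sub>C \<in> N" "C = frac (x p\<^sub>C)"
      by auto
    have c_le: "c \<le> frac (x p)" and C_ge: "frac (x p) \<le> C" if "p \<in> N" for p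
      using that finN by (auto simp: c_def C_def)
    have c: "0 < c" and C: "C < 1"
      using p by (auto simp: N_def frac_gt_0_iff frac_lt_1)
    have down: "shift (- c) \<in> convex_hull_on P (?Q \<inter> (P \<rightarrow>\<^sub>E \<int>))"
    proof (rule shift_hull)
      show "of_int \<lfloor>x p\<rfloor> \<le> x p + - c" if "p \<in> N" for p
        using c_le[OF that] by (simp add: frac_def)
      show "x p + - c \<le> of_int \<lfloor>x p\<rfloor> + 1" for p
        using c by linarith
      show "x p\<^sub>c + - c \<in> \<int>"
        by (simp add: p(2) frac_def)
    qed (rule p(1))
    have up: "shift (1 - C) \<in> convex_hull_on P (?Q \<inter> (P \<rightarrow>\<^sub>E \<int>))"
    proof (rule shift_hull)
      show "of_int \<lfloor>x p\<rfloor> \<le> x p + (1 - C)" for p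
        using C by linarith
      show "x p + (1 - C) \<le> of_int \<lfloor>x p\<rfloor> + 1" if "p \<in> N" for p
        using C_ge[OF that] by (simp add: frac_def)
      show "x p\<^sub>C + (1 - C) \<in> \<int>"
        by (simp add: p(4) frac_def)
    qed (rule p(3))
    \<comment> \<open>This weight balances the two shifts:
      \<open>- (1 - t) * c + t * (1 - C) = 0\<close>.\<close>
    define t where "t = c / (c + (1 - C))"
    have t: "0 \<le> t" "t \<le> 1" "t * (c + (1 - C)) = c"
      using c C by (auto simp: t_def field_simps)
    have "(1 - t) * shift (- c) p + t * shift (1 - C) p = x p" if "p \<in> P" for p
    proof (cases "p \<in> N")
      case True
      then have "(1 - t) * shift (- c) p + t * shift (1 - C) p = x p - c + t * (c + (1 - C))"
        using that by (simp add: shift_def algebra_simps)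
      then show ?thesis using t(3) by simp
    next
      case False
      then show ?thesis using that by (simp add: shift_def algebra_simps)
    qed
    then have "(\<lambda>p\<in>P. (1 - t) * shift (- c) p + t * shift (1 - C) p) = x"
      using x(1) by (auto simp: fun_eq_iff PiE_iff extensional_def)
    then show ?thesis
      using convex_hull_on_segment[OF down up t(1,2)] by simp
  qed
qed

text \<open>The defining conditions are linear, hence inherited by convex combinations; the marks
  survive because the weights sum to one.\<close>

lemma hull_subset_marked_order_polytope:
  assumes "A \<subseteq> P" and "V \<subseteq> marked_order_polytope P r A lam"
  shows "convex_hull_on P V \<subseteq> marked_order_polytope P r A lam"
proof
  fix x assume "x \<in> convex_hull_on P V"
  then obtain c where c: "\<forall>v\<in>V. 0 \<le> c v" "(\<Sum>v\<in>V. c v) = 1" "x = (\<lambda>s\<in>P. \<Sum>v\<in>V. c v * v s)"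
    by (auto simp: convex_hull_on_def)
  have "order_preserving P r x"
    using assms(2) c(1)
    by (intro order_preservingI) (fastforce simp: c(3) marked_order_polytope_def intro!: sum_mono
        mult_left_mono dest: order_preservingD)
  moreover have "x a = of_int (lam a)" if "a \<in> A" for a
  proof -
    have "x a = (\<Sum>v\<in>V. c v * of_int (lam a))"
      using that assms by (auto simp: c(3) marked_order_polytope_def intro!: sum.cong)
    then show ?thesis by (simp add: c(2) flip: sum_distrib_right)
  qed
  ultimately show "x \<in> marked_order_polytope P r A lam"
    by (simp add: marked_order_polytope_def c(3))
qed

lemma marked_order_polytope_eq_hull:
  assumes "finite P" and "A \<subseteq> P" and "finite (marked_maps P r A lam 1)"
  shows "marked_order_polytope P r A lam =
    convex_hull_on P ((\<lambda>g. \<lambda>p\<in>P. real_of_int (g p)) ` marked_maps P r A lam 1)"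
proof -
  let ?Q = "marked_order_polytope P r A lam"
  have "dilate P 1 ?Q = ?Q"
    by (rule dilate_1) (auto simp: marked_order_polytope_def)
  then have V: "?Q \<inter> (P \<rightarrow>\<^sub>E \<int>) = (\<lambda>g. \<lambda>p\<in>P. real_of_int (g p)) ` marked_maps P r A lam 1"
    using lattice_points_dilate[OF assms(2), of 1 r lam] by simp
  have "finite (?Q \<inter> (P \<rightarrow>\<^sub>E \<int>))"
    unfolding V using assms(3) by simp
  then show ?thesis
    unfolding V[symmetric]
    using marked_order_polytope_subset_hull[OF assms(1,2)]
      hull_subset_marked_order_polytope[OF assms(2) Int_lower1]
    by (intro equalityI subsetI) blast+
qed

section \<open>The Ehrhart polynomial as a sum of products of order polynomials\<close>

theorem theorem1p4:
  fixes F :: "('a set \<times> 'a rel) set"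
    and P A :: "'a set" and r :: "'a rel" and lam :: "'a \<Rightarrow> int"
  assumes finite_posets: "\<And>Q s. (Q, s) \<in> F \<Longrightarrow> finite Q \<and> partial_order_on Q s"
    and ideal_closed: "\<And>Q s I. (Q, s) \<in> F \<Longrightarrow> order_ideal Q s I \<Longrightarrow> (I, Restr s I) \<in> F"
    and filter_closed: "\<And>Q s J. (Q, s) \<in> F \<Longrightarrow> order_filter Q s J \<Longrightarrow> (J, Restr s J) \<in> F"
    and linear_coeff: "\<And>Q s. (Q, s) \<in> F \<Longrightarrow> 0 \<le> coeff (order_polynomial Q s) 1"
    and "(P, r) \<in> F"
    and "A \<subseteq> P"
    and "min_elements P r \<union> max_elements P r \<subseteq> A"
  shows "ehrhart_positive P (marked_order_polytope P r A lam)"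
proof -
  interpret positive_poset_family F
    using assms(1-4) by unfold_locales
  have fin: "finite P" and order: "partial_order_on P r"
    using finite_posets \<open>(P, r) \<in> F\<close> by blast+
  have refl: "refl_on P r" and trans: "trans r"
    using order by (auto simp: partial_order_on_def preorder_on_def)
  let ?Q = "marked_order_polytope P r A lam" and ?M = "marked_maps P r A lam"
  let ?emb = "\<lambda>g. \<lambda>p\<in>P. real_of_int (g p)"
  let ?W = "\<lambda>h k. {p \<in> unforced P r A h. h p = k}"
  note fin_M = finite_marked_maps[OF fin order assms(6,7)]
  have hull: "?Q = convex_hull_on P (?emb ` ?M 1)"
    using fin \<open>A \<subseteq> P\<close> fin_M by (rule marked_order_polytope_eq_hull)
  have "lattice_polytope P ?Q"
    unfolding lattice_polytope_def
    using hull fin_M by (intro exI[of _ "?emb ` ?M 1"]) auto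

  \<comment> \<open>\<open>E\<close> is read off from \<open>card_marked_maps\<close> by replacing
    each count with its order polynomial.\<close>
  moreover define E where "E = (\<Sum>h\<in>?M 1. \<Prod>k\<in>h ` unforced P r A h. order_polynomial (?W h k) r)"
  have poly_E: "poly E (real n) =
      real (\<Sum>h\<in>?M 1. \<Prod>k\<in>h ` unforced P r A h. card (order_maps (?W h k) r n))" for n
    using fin by (simp add: E_def poly_sum poly_prod poly_order_polynomial unforced_def)
  have count: "poly E (real n) = real (card (dilate P n ?Q \<inter> (P \<rightarrow>\<^sub>E \<int>)))" for n
  proof (cases "n = 0")
    case False
    have "inj_on ?emb (?M n)"
      by (rule inj_onI) (auto simp: marked_maps_def fun_eq_iff PiE_iff extensional_def, metis of_int_eq_iff)
    then have "card (dilate P n ?Q \<inter> (P \<rightarrow>\<^sub>E \<int>)) = card (?M n)"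
      using False \<open>A \<subseteq> P\<close> by (simp add: lattice_points_dilate card_image)
    then show ?thesis
      using card_marked_maps[OF fin refl trans \<open>A \<subseteq> P\<close> _ fin_M fin_M] False by (simp add: poly_E)
  next
    case True
    \<comment> \<open>A nonempty level set of unforced elements has no map into the empty set, while
      the empty product is one: only fully forced \<open>h\<close> contribute.\<close>
    have "(\<Prod>k\<in>h ` unforced P r A h. card (order_maps (?W h k) r 0)) =
        (if unforced P r A h = {} then 1 else 0)" for h
    proof (cases "unforced P r A h = {}")
      case False
      then obtain p where "p \<in> unforced P r A h" by blast
      then have "card (order_maps (?W h (h p)) r 0) = 0"
        by (intro card_order_maps_0) auto
      then show ?thesis
        using fin False \<open>p \<in> unforced P r A h\<close> by (auto simp: unforced_def intro!: prod_zero)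
    qed simp
    then have E0: "poly E (real n) = real (card {h \<in> ?M 1. unforced P r A h = {}})"
      unfolding poly_E True using fin_M[of lam 1] by (simp add: sum.If_cases Int_def)
    \<comment> \<open>An empty polytope has no points in its zeroth dilate and no \<open>h\<close>
      at all; a nonempty one leaves just the origin, matched by the unique fully forced
      \<open>h\<close>.\<close>
    show ?thesis
    proof (cases "?M 1 = {}")
      case True
      then have "?Q = {}" using hull by (simp add: convex_hull_on_empty)
      then show ?thesis using E0 True by (simp add: dilate_def)
    next
      case False
      then have "\<exists>!h. h \<in> ?M 1 \<and> unforced P r A h = {}"
        using assms(7) by (intro unique_fully_forced[OF fin order \<open>A \<subseteq> P\<close>]) auto
      then have "card {h \<in> ?M 1. unforced P r A h = {}} = 1"
        by (simp add: card_1_singleton_iff) blast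
      moreover have "?Q \<noteq> {}"
        using False fin_M convex_hull_on_inc[of "?emb ` ?M 1" _ P] unfolding hull by fastforce
      ultimately show ?thesis
        using E0 by (simp add: True dilate_0 PiE_iff Int_absorb2)
    qed
  qed
  have "ehrhart_polynomial P ?Q = E"
    unfolding ehrhart_polynomial_def
    by (rule the_equality) (auto simp: count intro!: poly_eqI_nat[of 0])

  moreover have "0 \<le> coeff (order_polynomial (?W h k) r) i" if "h \<in> ?M 1" for h k i
  proof -
    have mono: "h p \<le> h q" if "(p, q) \<in> r" "p \<in> P" "q \<in> P" for p q
      using \<open>h \<in> ?M 1\<close> that by (auto simp: marked_maps_def dest: order_preservingD)
    let ?I = "{p \<in> P. h p \<le> k}" and ?L = "{p \<in> P. h p = k}"
    have "order_ideal P r ?I"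
      using mono by (force simp: order_ideal_def)
    then have "(?I, Restr r ?I) \<in> F"
      by (rule ideal_closed[OF \<open>(P, r) \<in> F\<close>])
    moreover have "order_filter ?I (Restr r ?I) ?L"
      using mono by (force simp: order_filter_def)
    ultimately have "(?L, Restr (Restr r ?I) ?L) \<in> F"
      by (rule filter_closed)
    \<comment> \<open>By transitivity, a mark forcing an element also forces everything above it in
      the same level set.\<close>
    moreover have "order_ideal ?L (Restr (Restr r ?I) ?L) (?W h k)"
      unfolding order_ideal_def unforced_def using trans by (auto dest: transD)
    ultimately have "(?W h k, Restr (Restr (Restr r ?I) ?L) (?W h k)) \<in> F"
      by (rule ideal_closed)
    then have "0 \<le> coeff (order_polynomial (?W h k) (Restr (Restr (Restr r ?I) ?L) (?W h k))) i"
      by (rule order_polynomial_nonneg)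
    \<comment> \<open>These inclusions let the nested restrictions be removed, leaving the order
      polynomial with respect to \<open>r\<close>.\<close>
    moreover have "?W h k \<subseteq> ?L" "?W h k \<subseteq> ?I"
      by (auto simp: unforced_def)
    ultimately show ?thesis
      by (simp only: order_polynomial_Restr order_refl)
  qed
  then have "0 \<le> coeff E i" for i
    unfolding E_def coeff_sum by (intro sum_nonneg nonneg_coeff_prod)
  ultimately show ?thesis
    by (simp add: ehrhart_positive_def)
qed

end
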